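(* Let $T$ be a tree with non-negative vertex and edge weights and a start vertex $v_s$, and consider the minimal number of agents required for the strategic deployment problem on $T$. Then there is always a deployment strategy using this minimal number of agents in which all non-settled agents move in a single group.
   Context: Strategic deployment problem: Let $G=(V,E)$ be a connected graph (here a tree) with non-negative vertex weights $w_v$ and edge weights $w_e$, and start vertex $v_s$. Some number $k$ of agents start at $v_s$. In each discrete time step every non-settled agent either stays at its vertex or moves along an incident edge; agents may in general split into several groups moving separately. When a vertex $v$ is reached by agents for the first time, $w_v$ of the agents present must be left at $v$ permanently; these agents are called settled, all other agents are non-settled. An edge $e$ may be traversed in a step only if at least $w_e$ agents traverse it together. A strategy is valid if every vertex gets filled (receives its settled agents). The minimal number of agents required is the minimum $k$ for which a valid strategy exists. *)

theory Defs
  imports Complex_Main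
begin

section \<open>Finite simple undirected graphs and trees\<close>

definition simple_graph :: "'v set \<Rightarrow> 'v set set \<Rightarrow> bool" where
  "simple_graph V E \<longleftrightarrow> finite V \<and> (\<forall>e\<in>E. e \<subseteq> V \<and> card e = 2)"

definition connected_graph :: "'v set \<Rightarrow> 'v set set \<Rightarrow> bool" where
  "connected_graph V E \<longleftrightarrow> V \<noteq> {} \<and> (\<forall>u\<in>V. \<forall>v\<in>V. (u, v) \<in> {(x, y). {x, y} \<in> E}\<^sup>*)"

definition is_cycle :: "'v set set \<Rightarrow> 'v list \<Rightarrow> bool" where
  "is_cycle E c \<longleftrightarrow> 3 \<le> length c \<and> distinct c \<and>
     (\<forall>i<length c. {c ! i, c ! (Suc i mod length c)} \<in> E)"

definition is_tree :: "'v set \<Rightarrow> 'v set set \<Rightarrow> bool" where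
  "is_tree V E \<longleftrightarrow> simple_graph V E \<and> connected_graph V E \<and> (\<nexists>c. is_cycle E c)"


section \<open>Deployment strategies\<close>

text \<open>
  The agents are the numbers \<open>a < k\<close>. \<open>pos S t a\<close> is the vertex at which agent \<open>a\<close> is after
  \<open>t\<close> steps, and \<open>settle S t\<close> is the set of agents that become settled at time \<open>t\<close>, right
  after arriving (at time 0: before the first step). The positions of the numbers \<open>a \<ge> k\<close>
  are meaningless.
\<close>

record 'v strategy =
  pos :: "nat \<Rightarrow> nat \<Rightarrow> 'v"
  settle :: "nat \<Rightarrow> nat set"

definition settled :: "'v strategy \<Rightarrow> nat \<Rightarrow> nat set" where
  "settled S t = (\<Union>s\<in>{..t}. settle S s)"

definition nonsettled :: "nat \<Rightarrow> 'v strategy \<Rightarrow> nat \<Rightarrow> nat set" where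
  "nonsettled k S t = {..<k} - settled S t"

definition first_reached :: "nat \<Rightarrow> 'v strategy \<Rightarrow> nat \<Rightarrow> 'v \<Rightarrow> bool" where
  "first_reached k S t v \<longleftrightarrow>
     (\<exists>a<k. pos S t a = v) \<and> (\<forall>s<t. \<forall>a<k. pos S s a \<noteq> v)"

definition crossing :: "nat \<Rightarrow> 'v strategy \<Rightarrow> nat \<Rightarrow> 'v \<Rightarrow> 'v \<Rightarrow> nat set" where
  "crossing k S t u v = {a. a < k \<and> pos S t a = u \<and> pos S (Suc t) a = v}"

text \<open>
  Agents crossing an edge in opposite directions in the same step do not cross it together,
  so the edge weight is compared with the number of agents in each direction separately.
\<close>

definition legal_moves ::
    "'v set set \<Rightarrow> ('v set \<Rightarrow> real) \<Rightarrow> 'v \<Rightarrow> nat \<Rightarrow> 'v strategy \<Rightarrow> bool" where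
  "legal_moves E we vs k S \<longleftrightarrow>
     (\<forall>a<k. pos S 0 a = vs) \<and>
     (\<forall>t. \<forall>a<k. pos S (Suc t) a = pos S t a \<or> {pos S t a, pos S (Suc t) a} \<in> E) \<and>
     (\<forall>t. \<forall>a\<in>settled S t. pos S (Suc t) a = pos S t a) \<and>
     (\<forall>t u v. {u, v} \<in> E \<longrightarrow> crossing k S t u v \<noteq> {} \<longrightarrow>
        we {u, v} \<le> real (card (crossing k S t u v)))"

text \<open>
  Exactly \<open>wv v\<close> agents settle when \<open>v\<close> is reached for the first time, and no agents settle
  at any other place or time.
\<close>

definition legal_settling :: "('v \<Rightarrow> nat) \<Rightarrow> nat \<Rightarrow> 'v strategy \<Rightarrow> bool" where
  "legal_settling wv k S \<longleftrightarrow>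
     (\<forall>t. settle S t \<subseteq> {..<k}) \<and>
     (\<forall>s t. s \<noteq> t \<longrightarrow> settle S s \<inter> settle S t = {}) \<and>
     (\<forall>t v. card {a \<in> settle S t. pos S t a = v} = (if first_reached k S t v then wv v else 0))"

text \<open>A vertex of weight 0 is filled by being reached.\<close>

definition filled :: "('v \<Rightarrow> nat) \<Rightarrow> nat \<Rightarrow> 'v strategy \<Rightarrow> 'v \<Rightarrow> bool" where
  "filled wv k S v \<longleftrightarrow>
     (\<exists>t. first_reached k S t v \<and> card {a \<in> settled S t. pos S t a = v} = wv v)"

definition valid_strategy ::
    "'v set \<Rightarrow> 'v set set \<Rightarrow> ('v \<Rightarrow> nat) \<Rightarrow> ('v set \<Rightarrow> real) \<Rightarrow> 'v \<Rightarrow> nat \<Rightarrow> 'v strategy \<Rightarrow> bool" where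
  "valid_strategy V E wv we vs k S \<longleftrightarrow>
     legal_moves E we vs k S \<and> legal_settling wv k S \<and> (\<forall>v\<in>V. filled wv k S v)"

definition min_agents ::
    "'v set \<Rightarrow> 'v set set \<Rightarrow> ('v \<Rightarrow> nat) \<Rightarrow> ('v set \<Rightarrow> real) \<Rightarrow> 'v \<Rightarrow> nat" where
  "min_agents V E wv we vs = (LEAST k. \<exists>S. valid_strategy V E wv we vs k S)"

text \<open>
  The second conjunct excludes strategies in which some agents leave the group and settle
  immediately upon arrival while the others stay behind or move elsewhere.
\<close>

definition single_group :: "nat \<Rightarrow> 'v strategy \<Rightarrow> bool" where
  "single_group k S \<longleftrightarrow>
     (\<forall>t. \<forall>a\<in>nonsettled k S t. \<forall>b\<in>nonsettled k S t.
        pos S t a = pos S t b \<and> pos S (Suc t) a = pos S (Suc t) b)"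

end

theory Submission
  imports Defs
begin

section \<open>Connected vertex sets of a tree\<close>

text \<open>Every \<open>k\<close> that admits a valid strategy \<open>S\<close> admits one moving
  in a single group, and the minimum is such a \<open>k\<close>. A group that has filled a set of
  vertices keeps \<open>k\<close> minus their weight, so a good filling order suffices; it is read
  off from \<open>S\<close>.

  Take a heaviest edge \<open>e\<close> and the last time \<open>S\<close> crosses it, say from side
  \<open>A1\<close> into side \<open>A2\<close>. Afterwards the sides exchange no agents. So at that
  time \<open>S\<close> has at least \<open>mw e\<close> agents in \<open>A2\<close>, and none of
  them serves \<open>A1\<close> or the part of \<open>A2\<close> visited before. Hence a single
  group can fill \<open>A1\<close> and that part and still own \<open>mw e\<close> agents; as
  \<open>e\<close> is heaviest, it may do so in any order. It then enters \<open>A2\<close> for good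
  and the argument repeats there, starting from the state of \<open>S\<close> at that time. If
  \<open>e\<close> is not crossed any more, \<open>A2\<close> is the side where the group is.

  \<open>settling_count\<close> does the counting, \<open>last_crossing\<close> provides the cut,
  \<open>group_fills_isolated\<close> is the induction. The region to be filled is connected because
  visited sets are connected and \<open>connected_in_Int\<close> holds in trees.
  \<open>walk_strategy_valid\<close> turns the resulting walk into a strategy.\<close>

definition adj :: "'v set set \<Rightarrow> 'v set \<Rightarrow> ('v \<times> 'v) set" where
  "adj E X = {(u, v). {u, v} \<in> E \<and> u \<in> X \<and> v \<in> X}"

definition connected_in :: "'v set set \<Rightarrow> 'v set \<Rightarrow> bool" where
  "connected_in E X \<longleftrightarrow> (\<forall>u\<in>X. \<forall>v\<in>X. (u, v) \<in> (adj E X)\<^sup>*)"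

text \<open>For an edge \<open>{a, b}\<close> of a tree inside a connected \<open>B\<close>,
  \<open>branch E B a b\<close> and \<open>branch E B b a\<close> are the two components left by
  deleting that edge.\<close>

definition branch :: "'v set set \<Rightarrow> 'v set \<Rightarrow> 'v \<Rightarrow> 'v \<Rightarrow> 'v set" where
  "branch E B a b = {x \<in> B. (a, x) \<in> (adj (E - {{a, b}}) B)\<^sup>*}"

section \<open>Reachability inside a vertex set\<close>

lemma adj_sym: "sym (adj E X)"
  by (auto simp: sym_def adj_def insert_commute)

lemma rtrancl_adj_sym: "(x, y) \<in> (adj E X)\<^sup>* \<Longrightarrow> (y, x) \<in> (adj E X)\<^sup>*"
  by (meson adj_sym sym_rtrancl symD)

lemma rtrancl_adj_mono:
  assumes "(x, y) \<in> (adj E X)\<^sup>*" "E \<subseteq> E'" "X \<subseteq> X'"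
  shows "(x, y) \<in> (adj E' X')\<^sup>*"
proof -
  have "adj E X \<subseteq> adj E' X'" using assms(2,3) by (auto simp: adj_def)
  then show ?thesis using assms(1) rtrancl_mono by blast
qed

lemma connected_inI:
  assumes "\<And>x. x \<in> X \<Longrightarrow> (c, x) \<in> (adj E X)\<^sup>*"
  shows "connected_in E X"
  unfolding connected_in_def using assms rtrancl_adj_sym rtrancl_trans by metis

lemma connected_inD: "connected_in E X \<Longrightarrow> u \<in> X \<Longrightarrow> v \<in> X \<Longrightarrow> (u, v) \<in> (adj E X)\<^sup>*"
  by (simp add: connected_in_def)

lemma connected_in_insert:
  assumes "connected_in E X" "z \<in> X" "{z, y} \<in> E"
  shows "connected_in E (insert y X)"
proof (rule connected_inI)
  fix x assume "x \<in> insert y X"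
  show "(z, x) \<in> (adj E (insert y X))\<^sup>*"
  proof (cases "x \<in> X")
    case True
    then show ?thesis
      using connected_inD[OF assms(1,2)] rtrancl_adj_mono[of z x E X E "insert y X"] by blast
  next
    case False
    then have "(z, x) \<in> adj E (insert y X)"
      using \<open>x \<in> insert y X\<close> assms(2,3) by (auto simp: adj_def)
    then show ?thesis by blast
  qed
qed

lemma connected_in_Un_edge:
  assumes "connected_in E X" "connected_in E Y" "x \<in> X" "y \<in> Y" "{x, y} \<in> E"
  shows "connected_in E (X \<union> Y)"
proof (rule connected_inI)
  fix z assume z: "z \<in> X \<union> Y"
  have xy: "(x, y) \<in> (adj E (X \<union> Y))\<^sup>*" using assms by (auto simp: adj_def)
  show "(x, z) \<in> (adj E (X \<union> Y))\<^sup>*"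
  proof (cases "z \<in> X")
    case True
    then show ?thesis using connected_inD[OF assms(1,3)] rtrancl_adj_mono[of x z E X E "X \<union> Y"] by blast
  next
    case False
    then have "(y, z) \<in> (adj E (X \<union> Y))\<^sup>*"
      using z connected_inD[OF assms(2,4)] rtrancl_adj_mono[of y z E Y E "X \<union> Y"] by blast
    then show ?thesis using xy by (rule rtrancl_trans[rotated])
  qed
qed

lemma rtrancl_distinct_path:
  assumes "(x, y) \<in> r\<^sup>*"
  shows "\<exists>xs. xs \<noteq> [] \<and> hd xs = x \<and> last xs = y \<and> distinct xs \<and>
           successively (\<lambda>u v. (u, v) \<in> r) xs"
  using assms
proof (induction rule: converse_rtrancl_induct)
  case base
  have "[y] \<noteq> [] \<and> hd [y] = y \<and> last [y] = y \<and> distinct [y] \<and>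
      successively (\<lambda>u v. (u, v) \<in> r) [y]" by simp
  then show ?case by blast
next
  case (step x z)
  then obtain xs where xs: "xs \<noteq> []" "hd xs = z" "last xs = y" "distinct xs"
    "successively (\<lambda>u v. (u, v) \<in> r) xs" by blast
  show ?case
  proof (cases "x \<in> set xs")
    case True
    then obtain us ws where "xs = us @ x # ws" by (meson split_list)
    then have "x # ws \<noteq> [] \<and> hd (x # ws) = x \<and> last (x # ws) = y \<and> distinct (x # ws) \<and>
        successively (\<lambda>u v. (u, v) \<in> r) (x # ws)"
      using xs by (auto simp: successively_append_iff)
    then show ?thesis by blast
  next
    case False
    then have "x # xs \<noteq> [] \<and> hd (x # xs) = x \<and> last (x # xs) = y \<and> distinct (x # xs) \<and>
        successively (\<lambda>u v. (u, v) \<in> r) (x # xs)"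
      using xs step(1) by (auto simp: successively_Cons)
    then show ?thesis by blast
  qed
qed

section \<open>Tree edges as bridges and the two sides of an edge\<close>

lemma tree_edge_neq: "is_tree V E \<Longrightarrow> {a, b} \<in> E \<Longrightarrow> a \<noteq> b"
  by (auto simp: is_tree_def simple_graph_def)

text \<open>A detour from \<open>a\<close> to \<open>b\<close> closes up with the edge to a cycle.
  It has at least three vertices, as the only path on two would use the deleted edge.\<close>

lemma tree_edge_is_bridge:
  assumes tree: "is_tree V E" and ab: "{a, b} \<in> E"
  shows "(a, b) \<notin> (adj (E - {{a, b}}) UNIV)\<^sup>*"
proof
  assume "(a, b) \<in> (adj (E - {{a, b}}) UNIV)\<^sup>*"
  then obtain xs where xs: "xs \<noteq> []" "hd xs = a" "last xs = b" "distinct xs"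
    "successively (\<lambda>u v. (u, v) \<in> adj (E - {{a, b}}) UNIV) xs"
    using rtrancl_distinct_path by metis
  have neq: "a \<noteq> b" using tree_edge_neq[OF assms] .
  have succ: "{xs ! i, xs ! Suc i} \<in> E - {{a, b}}" if "Suc i < length xs" for i
    using xs(5) that by (auto simp: successively_conv_nth adj_def)
  have h: "xs ! 0 = a" "xs ! (length xs - 1) = b"
    using xs by (auto simp: hd_conv_nth last_conv_nth)
  have "length xs \<noteq> 0" "length xs \<noteq> 1" using xs(1) h neq by auto
  moreover have "length xs \<noteq> 2" using succ[of 0] h by (auto simp: numeral_2_eq_2)
  ultimately have len: "3 \<le> length xs" by linarith
  have "{xs ! i, xs ! (Suc i mod length xs)} \<in> E" if "i < length xs" for i
  proof (cases "Suc i < length xs")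
    case True
    then show ?thesis using succ by auto
  next
    case False
    then have "i = length xs - 1" "Suc i = length xs" using that by auto
    then show ?thesis using h ab by (simp add: insert_commute)
  qed
  then have "is_cycle E xs" using len xs(4) by (simp add: is_cycle_def)
  then show False using tree by (auto simp: is_tree_def)
qed

lemma branch_subset: "branch E B a b \<subseteq> B"
  by (auto simp: branch_def)

lemma branch_self: "a \<in> B \<Longrightarrow> a \<in> branch E B a b"
  by (auto simp: branch_def)

lemma connected_in_branch:
  assumes "a \<in> B" shows "connected_in E (branch E B a b)"
proof (rule connected_inI)
  fix x assume "x \<in> branch E B a b"
  then have "(a, x) \<in> (adj (E - {{a, b}}) B)\<^sup>*" by (simp add: branch_def)
  then show "(a, x) \<in> (adj E (branch E B a b))\<^sup>*"
  proof (induction rule: rtrancl_induct)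
    case base
    show ?case by simp
  next
    case (step y z)
    then have "y \<in> branch E B a b" "z \<in> branch E B a b"
      by (auto simp: branch_def adj_def intro: rtrancl_into_rtrancl)
    then have "(y, z) \<in> adj E (branch E B a b)" using step(2) by (auto simp: adj_def)
    then show ?case using step(3) by (rule rtrancl_into_rtrancl[rotated])
  qed
qed

lemma branch_cover:
  assumes "connected_in E B" "a \<in> B" "b \<in> B"
  shows "branch E B a b \<union> branch E B b a = B"
proof -
  have "x \<in> branch E B a b \<union> branch E B b a" if "x \<in> B" for x
    using connected_inD[OF assms(1,2) that]
  proof (induction rule: rtrancl_induct)
    case base
    show ?case using assms by (auto simp: branch_def)
  next
    case (step y z)
    have z: "z \<in> B" using step(2) by (auto simp: adj_def)
    show ?case
    proof (cases "{y, z} = {a, b}")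
      case True
      then have "z = a \<or> z = b" by (auto simp: doubleton_eq_iff)
      then show ?thesis using branch_self z by fast
    next
      case False
      then have "(y, z) \<in> adj (E - {{a, b}}) B" "(y, z) \<in> adj (E - {{b, a}}) B"
        using step(2) by (auto simp: adj_def insert_commute)
      then show ?thesis using step(3) z by (auto simp: branch_def intro: rtrancl_into_rtrancl)
    qed
  qed
  then show ?thesis using branch_subset by fast
qed

text \<open>Such a path would complete a detour around the bridge. It is excluded in the whole
  graph, so that the result applies to sets not contained in \<open>B\<close>.\<close>

lemma no_path_between_branches:
  assumes tree: "is_tree V E" and ab: "{a, b} \<in> E"
    and x: "x \<in> branch E B a b" and y: "y \<in> branch E B b a"
  shows "(x, y) \<notin> (adj (E - {{a, b}}) UNIV)\<^sup>*"
proof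
  assume xy: "(x, y) \<in> (adj (E - {{a, b}}) UNIV)\<^sup>*"
  have "(a, x) \<in> (adj (E - {{a, b}}) B)\<^sup>*" "(b, y) \<in> (adj (E - {{a, b}}) B)\<^sup>*"
    using x y by (auto simp: branch_def insert_commute)
  then have "(a, x) \<in> (adj (E - {{a, b}}) UNIV)\<^sup>*" "(y, b) \<in> (adj (E - {{a, b}}) UNIV)\<^sup>*"
    by (auto intro: rtrancl_adj_mono rtrancl_adj_sym)
  then show False using xy tree_edge_is_bridge[OF tree ab] by (meson rtrancl_trans)
qed

lemma branch_disjoint:
  assumes "is_tree V E" "{a, b} \<in> E"
  shows "branch E B a b \<inter> branch E B b a = {}"
  using no_path_between_branches[OF assms] by blast

lemma branch_edge:
  assumes "is_tree V E" "{a, b} \<in> E" "x \<in> branch E B a b" "y \<in> branch E B b a" "{x, y} \<in> E"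
  shows "x = a \<and> y = b"
proof -
  have "{x, y} = {a, b}"
  proof (rule ccontr)
    assume "{x, y} \<noteq> {a, b}"
    then have "(x, y) \<in> adj (E - {{a, b}}) UNIV" using assms(5) by (auto simp: adj_def)
    then show False using no_path_between_branches[OF assms(1-4)] by blast
  qed
  moreover have "b \<notin> branch E B a b"
  proof
    assume "b \<in> branch E B a b"
    moreover from this have "b \<in> branch E B b a"
      by (auto simp: branch_def)
    ultimately show False using branch_disjoint[OF assms(1,2)] by blast
  qed
  ultimately show ?thesis using assms(3) by (auto simp: doubleton_eq_iff)
qed

lemma connected_set_contains_cut_vertex:
  assumes "is_tree V E" "{a, b} \<in> E" "x \<in> branch E B a b" "y \<in> branch E B b a"
    and X: "connected_in E X" "x \<in> X" "y \<in> X"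
  shows "b \<in> X"
proof (rule ccontr)
  assume "b \<notin> X"
  then have "adj E X \<subseteq> adj (E - {{a, b}}) UNIV" by (auto simp: adj_def doubleton_eq_iff)
  then have "(x, y) \<in> (adj (E - {{a, b}}) UNIV)\<^sup>*"
    using connected_inD[OF X] rtrancl_mono by blast
  then show False using no_path_between_branches[OF assms(1-4)] by blast
qed

text \<open>If \<open>v\<close> lay outside the component \<open>C\<close> of \<open>u\<close>, a
  walk in \<open>Y\<close> from \<open>v\<close> to \<open>u\<close> would enter \<open>C\<close>
  over some edge from \<open>d\<close> to \<open>c\<close>, where \<open>d\<close> is outside
  \<open>X\<close>. Then \<open>X\<close> joins \<open>v\<close> to \<open>c\<close> and
  \<open>Y - C\<close> joins \<open>v\<close> to \<open>d\<close>, both without this edge, which is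
  however a bridge.\<close>

lemma connected_in_Int:
  assumes tree: "is_tree V E" and X: "connected_in E X" and Y: "connected_in E Y"
  shows "connected_in E (X \<inter> Y)"
  unfolding connected_in_def
proof (intro ballI, rule ccontr)
  fix u v assume u: "u \<in> X \<inter> Y" and v: "v \<in> X \<inter> Y" and n: "(u, v) \<notin> (adj E (X \<inter> Y))\<^sup>*"
  define C where "C = {x \<in> X \<inter> Y. (u, x) \<in> (adj E (X \<inter> Y))\<^sup>*}"
  have vC: "v \<notin> C" using n by (simp add: C_def)
  have "(\<exists>d c. (v, d) \<in> (adj E (Y - C))\<^sup>* \<and> d \<in> Y - C \<and> c \<in> C \<and> {d, c} \<in> E) \<or>
        (v, z) \<in> (adj E (Y - C))\<^sup>* \<and> z \<in> Y - C" if "(v, z) \<in> (adj E Y)\<^sup>*" for z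
    using that
  proof (induction rule: rtrancl_induct)
    case base
    show ?case using v vC by blast
  next
    case (step y z)
    then show ?case
      by (cases "z \<in> C") (auto simp: adj_def intro: rtrancl_into_rtrancl)
  qed
  moreover have "(v, u) \<in> (adj E Y)\<^sup>*" using connected_inD[OF Y] u v by blast
  moreover have "u \<in> C" using u by (simp add: C_def)
  ultimately obtain d c where dc: "(v, d) \<in> (adj E (Y - C))\<^sup>*" "d \<in> Y - C" "c \<in> C" "{d, c} \<in> E"
    by blast
  have "d \<notin> X"
  proof
    assume "d \<in> X"
    then have "(c, d) \<in> adj E (X \<inter> Y)" using dc by (auto simp: adj_def C_def insert_commute)
    then have "d \<in> C" using dc \<open>d \<in> X\<close> by (auto simp: C_def intro: rtrancl_into_rtrancl)
    then show False using dc by blast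
  qed
  have "adj E X \<subseteq> adj (E - {{d, c}}) UNIV" using \<open>d \<notin> X\<close> by (auto simp: adj_def doubleton_eq_iff)
  moreover have "(v, c) \<in> (adj E X)\<^sup>*" using connected_inD[OF X] v dc by (auto simp: C_def)
  ultimately have vc: "(v, c) \<in> (adj (E - {{d, c}}) UNIV)\<^sup>*" using rtrancl_mono by blast
  have "adj E (Y - C) \<subseteq> adj (E - {{d, c}}) UNIV" using dc by (auto simp: adj_def doubleton_eq_iff)
  then have "(v, d) \<in> (adj (E - {{d, c}}) UNIV)\<^sup>*" using dc rtrancl_mono by blast
  then have "(d, c) \<in> (adj (E - {{d, c}}) UNIV)\<^sup>*"
    using vc rtrancl_adj_sym rtrancl_trans by metis
  then show False using tree_edge_is_bridge[OF tree dc(4)] by blast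
qed

section \<open>Walks of a single group\<close>

text \<open>\<open>mw\<close> stands for the edge weights rounded up to positive integers.\<close>

locale weighted_tree =
  fixes V :: "'v set" and E :: "'v set set" and wv :: "'v \<Rightarrow> nat" and mw :: "'v set \<Rightarrow> nat"
    and vs :: 'v
  assumes tree: "is_tree V E" and vs: "vs \<in> V" and mw_pos: "1 \<le> mw e"
begin

text \<open>
  In a state \<open>(G, p)\<close> the group is at \<open>p\<close>, and \<open>G\<close> is the set of the vertices it has left before;
  the settling at \<open>p\<close> is postponed to the departure, so \<open>p\<close> may be outside of \<open>G\<close>.
\<close>

inductive group_step :: "nat \<Rightarrow> 'v set \<times> 'v \<Rightarrow> 'v set \<times> 'v \<Rightarrow> bool" for k where
  stay: "group_step k (G, p) (insert p G, p)"
| move: "{p, q} \<in> E \<Longrightarrow> mw {p, q} + sum wv (insert p G) \<le> k \<Longrightarrow>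
    group_step k (G, p) (insert p G, q)"

lemma finite_V: "finite V"
  using tree by (simp add: is_tree_def simple_graph_def)

lemma edge_subset: "e \<in> E \<Longrightarrow> e \<subseteq> V"
  using tree by (simp add: is_tree_def simple_graph_def)

lemma connected_V: "connected_in E V"
proof -
  have "adj E V = {(x, y). {x, y} \<in> E}" using edge_subset by (auto simp: adj_def)
  then show ?thesis using tree by (auto simp: connected_in_def is_tree_def connected_graph_def)
qed

text \<open>\<open>allowed\<close> charges each edge of \<open>D\<close> as if all of
  \<open>G \<union> D\<close> were filled already, so the steps are affordable whatever is filled so
  far.\<close>

lemma walk_in_connected_set:
  assumes "(u, v) \<in> (adj E D)\<^sup>*" "u \<in> D" "finite (G \<union> D)"
    and allowed: "\<And>e. e \<in> E \<Longrightarrow> e \<subseteq> D \<Longrightarrow> mw e + sum wv (G \<union> D) \<le> k"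
    and H: "H \<subseteq> G \<union> D"
  shows "\<exists>H'. (group_step k)\<^sup>*\<^sup>* (H, u) (H', v) \<and> insert v H \<subseteq> H' \<and> H' \<subseteq> G \<union> D"
  using assms(1)
proof (induction rule: rtrancl_induct)
  case base
  have "group_step k (H, u) (insert u H, u)" by (rule stay)
  then show ?case using H assms(2) by blast
next
  case (step y z)
  then obtain H' where H': "(group_step k)\<^sup>*\<^sup>* (H, u) (H', y)" "insert y H \<subseteq> H'" "H' \<subseteq> G \<union> D"
    by blast
  have yz: "{y, z} \<in> E" "y \<in> D" "z \<in> D" using step(2) by (auto simp: adj_def)
  have sub: "insert y H' \<subseteq> G \<union> D" using H' yz by blast
  have "sum wv (insert y H') \<le> sum wv (G \<union> D)" using sub assms(3) by (intro sum_mono2) auto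
  then have "mw {y, z} + sum wv (insert y H') \<le> k" using allowed[of "{y, z}"] yz by auto
  then have "group_step k (H', y) (insert y H', z)" using yz by (intro move) auto
  moreover have "group_step k (insert y H', z) (insert z (insert y H'), z)" by (rule stay)
  ultimately have "(group_step k)\<^sup>*\<^sup>* (H, u) (insert z (insert y H'), z)"
    using H'(1) by (meson rtranclp.rtrancl_into_rtrancl)
  then show ?case using H' sub yz by blast
qed

text \<open>The vertices of \<open>D\<close> are visited one by one in arbitrary order, since the
  budget covers all of them in advance; the final walk to \<open>x\<close> fills nothing
  new.\<close>

lemma tour:
  assumes D: "connected_in E D" "q \<in> D" "x \<in> D" and fin: "finite (G \<union> D)"
    and allowed: "\<And>e. e \<in> E \<Longrightarrow> e \<subseteq> D \<Longrightarrow> mw e + sum wv (G \<union> D) \<le> k"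
  shows "(group_step k)\<^sup>*\<^sup>* (G, q) (G \<union> D, x)"
proof -
  have walk: "\<exists>H'. (group_step k)\<^sup>*\<^sup>* (H, u) (H', v) \<and> insert v H \<subseteq> H' \<and> H' \<subseteq> G \<union> D"
    if "u \<in> D" "v \<in> D" "H \<subseteq> G \<union> D" for u v H
    using walk_in_connected_set[OF connected_inD[OF D(1) that(1,2)] that(1) fin allowed that(3)] .
  have "\<exists>H p. (group_step k)\<^sup>*\<^sup>* (G, q) (H, p) \<and> p \<in> D \<and> G \<union> X \<subseteq> H \<and> H \<subseteq> G \<union> D"
    if "finite X" "X \<subseteq> D" for X
    using that
  proof (induction rule: finite_induct)
    case empty
    show ?case using D(2) by blast
  next
    case (insert v X)
    then obtain H p where H: "(group_step k)\<^sup>*\<^sup>* (G, q) (H, p)" "p \<in> D" "G \<union> X \<subseteq> H" "H \<subseteq> G \<union> D"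
      by blast
    then obtain H' where "(group_step k)\<^sup>*\<^sup>* (H, p) (H', v)" "insert v H \<subseteq> H'" "H' \<subseteq> G \<union> D"
      using walk[of p v H] insert by blast
    moreover from this have "(group_step k)\<^sup>*\<^sup>* (G, q) (H', v)" using H by auto
    ultimately show ?case using H insert by blast
  qed
  from this[of D] obtain H p where H: "(group_step k)\<^sup>*\<^sup>* (G, q) (H, p)" "p \<in> D" "H = G \<union> D"
    using fin by blast
  obtain H' where H': "(group_step k)\<^sup>*\<^sup>* (H, p) (H', x)" "insert x H \<subseteq> H'" "H' \<subseteq> G \<union> D"
    using walk[of p x H] H D by blast
  have "H' = G \<union> D" using H(3) H'(2,3) by blast
  then show ?thesis using H(1) H'(1) by auto
qed

lemma group_steps_imp_walk:
  assumes "(group_step k)\<^sup>*\<^sup>* ({}, vs) (G, p)"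
  shows "\<exists>f n. f 0 = vs \<and> f n = p \<and> G = f ` {..<n} \<and>
    (\<forall>i<n. f (Suc i) = f i \<or>
       {f i, f (Suc i)} \<in> E \<and> mw {f i, f (Suc i)} + sum wv (f ` {..i}) \<le> k)"
  using assms
proof (induction "(G, p)" arbitrary: G p rule: rtranclp_induct)
  case base
  have "(\<lambda>_. vs) 0 = vs" by simp
  then show ?case by (intro exI[of _ "\<lambda>_::nat. vs"] exI[of _ 0]) auto
next
  case (step y)
  obtain H u where y: "y = (H, u)" by (cases y)
  with step(3) obtain f n where f: "f 0 = vs" "f n = u" "H = f ` {..<n}"
    "\<And>i. i < n \<Longrightarrow> f (Suc i) = f i \<or>
       {f i, f (Suc i)} \<in> E \<and> mw {f i, f (Suc i)} + sum wv (f ` {..i}) \<le> k" by blast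
  define g where "g = f(Suc n := p)"
  have img: "f ` {..n} = insert u H" using f(2,3) by (auto simp: lessThan_Suc_atMost[symmetric] lessThan_Suc)
  have G: "G = insert u H" "p = u \<or> {u, p} \<in> E \<and> mw {u, p} + sum wv (insert u H) \<le> k"
    using step(2) y by (auto elim: group_step.cases)
  have gi: "g ` {..i} = f ` {..i}" if "i \<le> n" for i using that by (auto simp: g_def)
  have "g 0 = vs" "g (Suc n) = p" using f by (auto simp: g_def)
  moreover have "G = g ` {..<Suc n}" using G(1) img gi[of n] by (simp add: lessThan_Suc_atMost)
  moreover have "g (Suc i) = g i \<or>
       {g i, g (Suc i)} \<in> E \<and> mw {g i, g (Suc i)} + sum wv (g ` {..i}) \<le> k" if "i < Suc n" for i
  proof (cases "i = n")
    case True
    then show ?thesis using G img gi[of n] f(2) by (auto simp: g_def)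
  next
    case False
    then have "i < n" using that by simp
    then show ?thesis using f(4)[of i] gi[of i] by (auto simp: g_def)
  qed
  ultimately show ?case by blast
qed

end

section \<open>From a walk of the group to a strategy\<close>

text \<open>
  Agents settle in the order of their numbers: agent \<open>a\<close> settles as soon as the
  total weight of the visited vertices exceeds \<open>a\<close>.
\<close>

primrec walk_pos :: "('v \<Rightarrow> nat) \<Rightarrow> (nat \<Rightarrow> 'v) \<Rightarrow> nat \<Rightarrow> nat \<Rightarrow> 'v" where
  "walk_pos wv f 0 a = f 0"
| "walk_pos wv f (Suc t) a = (if a < sum wv (f ` {..t}) then walk_pos wv f t a else f (Suc t))"

definition walk_strategy :: "('v \<Rightarrow> nat) \<Rightarrow> (nat \<Rightarrow> 'v) \<Rightarrow> 'v strategy" where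
  "walk_strategy wv f = \<lparr>pos = walk_pos wv f,
     settle = (\<lambda>t. {sum wv (f ` {..<t})..<sum wv (f ` {..t})})\<rparr>"

lemma walk_strategy_sel:
  "pos (walk_strategy wv f) = walk_pos wv f"
  "settle (walk_strategy wv f) t = {sum wv (f ` {..<t})..<sum wv (f ` {..t})}"
  by (simp_all add: walk_strategy_def)

lemma walk_pos_in_range: "walk_pos wv f t a \<in> f ` {..t}"
  by (induction t) (simp_all add: atMost_Suc)

lemma sum_image_atMost_mono: "s \<le> t \<Longrightarrow> sum wv (f ` {..s}) \<le> sum wv (f ` {..t})"
  for wv :: "'v \<Rightarrow> nat" and f :: "nat \<Rightarrow> 'v"
  by (rule sum_mono2) auto

lemma walk_pos_unsettled:
  assumes "sum wv (f ` {..<t}) \<le> a"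
  shows "walk_pos wv f t a = f t"
  using assms by (cases t) (auto simp: lessThan_Suc_atMost)

lemma settled_walk_strategy: "settled (walk_strategy wv f) t = {..<sum wv (f ` {..t})}"
proof (induction t)
  case 0
  show ?case by (simp add: settled_def walk_strategy_sel lessThan_atLeast0)
next
  case (Suc t)
  have "settled (walk_strategy wv f) (Suc t) =
      settled (walk_strategy wv f) t \<union> settle (walk_strategy wv f) (Suc t)"
    by (simp add: settled_def atMost_Suc Un_commute)
  moreover have "sum wv (f ` {..t}) \<le> sum wv (f ` {..Suc t})"
    by (rule sum_image_atMost_mono) simp
  ultimately show ?case
    by (simp only: Suc walk_strategy_sel lessThan_Suc_atMost ivl_disj_un_one(2))
qed

text \<open>With \<open>c t\<close> the weight visited up to time \<open>t\<close>, the agents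
  numbered from \<open>c t\<close> up to \<open>k\<close> are exactly the non-settled ones. They are
  all at \<open>f t\<close> and move together, so at least \<open>k - c t\<close> agents take part
  in a crossing. The summand 1 in \<open>step\<close> ensures that somebody is left to move, so that
  \<open>f (Suc t)\<close> is really reached.\<close>

lemma walk_strategy_valid:
  fixes wv :: "'v \<Rightarrow> nat" and we :: "'v set \<Rightarrow> real"
  assumes f0: "f 0 = vs" and k: "1 \<le> k" and fin: "finite V" and total: "sum wv V \<le> k"
    and card2: "\<And>e. e \<in> E \<Longrightarrow> card e = 2"
    and V: "range f = V"
    and step: "\<And>t. f (Suc t) = f t \<or> {f t, f (Suc t)} \<in> E \<and>
      1 + sum wv (f ` {..t}) \<le> k \<and> we {f t, f (Suc t)} + sum wv (f ` {..t}) \<le> k"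
  shows "valid_strategy V E wv we vs k (walk_strategy wv f)"
    and "single_group k (walk_strategy wv f)"
proof -
  define S where "S = walk_strategy wv f"
  define c where "c t = sum wv (f ` {..t})" for t
  note sel = walk_strategy_sel[of wv f, folded S_def]
  have ck: "c t \<le> k" for t
  proof -
    have "c t \<le> sum wv V" unfolding c_def using fin V by (intro sum_mono2) auto
    then show ?thesis using total by simp
  qed
  have before: "sum wv (f ` {..<Suc t}) = c t" for t by (simp add: c_def lessThan_Suc_atMost)
  have pos_Suc: "pos S (Suc t) a = (if a < c t then pos S t a else f (Suc t))" for t a
    by (simp add: sel c_def)
  have pos_free: "pos S t a = f t" if "c t \<le> a" for t a
  proof -
    have "sum wv (f ` {..<t}) \<le> c t" unfolding c_def by (rule sum_mono2) auto
    then show ?thesis using that walk_pos_unsettled[of wv f t a] by (simp add: sel)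
  qed
  have pos_settle: "pos S t a = f t" if "a \<in> settle S t" for t a
    using that walk_pos_unsettled[of wv f t a] by (simp add: sel)
  have reached: "\<exists>a<k. pos S t a = f t" for t
  proof (induction t)
    case 0
    then show ?case using k by (intro exI[of _ 0]) (auto simp: sel)
  next
    case (Suc t)
    show ?case
    proof (cases "f (Suc t) = f t")
      case True
      then show ?thesis using Suc pos_Suc by metis
    next
      case False
      then have "c t < k" using step[of t] by (simp add: c_def)
      then show ?thesis using pos_Suc[of t "c t"] by auto
    qed
  qed
  have first: "first_reached k S t v \<longleftrightarrow> v = f t \<and> v \<notin> f ` {..<t}" for t v
  proof
    assume l: "first_reached k S t v"
    then obtain a where a: "a < k" "pos S t a = v" "\<And>s. s < t \<Longrightarrow> pos S s a \<noteq> v"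
      by (auto simp: first_reached_def)
    have "v = f t"
    proof (cases t)
      case 0
      then show ?thesis using a by (simp add: sel)
    next
      case (Suc t')
      then show ?thesis using a pos_Suc[of t' a] by (auto split: if_splits)
    qed
    moreover have "v \<notin> f ` {..<t}" using l reached by (fastforce simp: first_reached_def)
    ultimately show "v = f t \<and> v \<notin> f ` {..<t}" ..
  next
    assume r: "v = f t \<and> v \<notin> f ` {..<t}"
    have "pos S s a \<noteq> v" if "s < t" for s a
      using walk_pos_in_range[of wv f s a] r that by (auto simp: sel)
    then show "first_reached k S t v" using r reached[of t] by (auto simp: first_reached_def)
  qed
  have card_settle: "card (settle S t) = (if f t \<in> f ` {..<t} then 0 else wv (f t))" for t
  proof -
    have "f ` {..t} = insert (f t) (f ` {..<t})"
      by (auto simp: lessThan_Suc_atMost[symmetric] lessThan_Suc)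
    then show ?thesis by (simp add: sel insert_absorb)
  qed
  have settle_c: "settle S t \<subseteq> {..<c t}" for t by (auto simp: sel c_def)
  have settled: "settled S t = {..<c t}" for t
    by (simp add: S_def c_def settled_walk_strategy)
  have c_mono: "s \<le> t \<Longrightarrow> c s \<le> c t" for s t
    unfolding c_def by (rule sum_image_atMost_mono)
  have c_before: "c s \<le> a" if "s < t" "a \<in> settle S t" for s t a
  proof -
    have "c s \<le> sum wv (f ` {..<t})" unfolding c_def using that by (intro sum_mono2) auto
    then show ?thesis using that by (simp add: sel)
  qed

  have moves: "legal_moves E we vs k S"
    unfolding legal_moves_def
  proof (intro conjI allI impI ballI)
    fix a show "pos S 0 a = vs" using f0 by (simp add: sel)
  next
    fix t a
    show "pos S (Suc t) a = pos S t a \<or> {pos S t a, pos S (Suc t) a} \<in> E"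
    proof (cases "a < c t")
      case True
      then show ?thesis by (simp add: pos_Suc)
    next
      case False
      then show ?thesis using step[of t] pos_free[of t a] by (auto simp: pos_Suc)
    qed
  next
    fix t a assume "a \<in> settled S t"
    then show "pos S (Suc t) a = pos S t a" by (simp add: settled pos_Suc)
  next
    fix t u v assume e: "{u, v} \<in> E" and ne: "crossing k S t u v \<noteq> {}"
    then obtain a where a: "a < k" "pos S t a = u" "pos S (Suc t) a = v"
      by (auto simp: crossing_def)
    have "u \<noteq> v" using card2[OF e] by auto
    then have ca: "c t \<le> a" using a by (auto simp: pos_Suc split: if_splits)
    then have uv: "u = f t" "v = f (Suc t)" using a pos_free[OF ca] by (auto simp: pos_Suc)
    have "{c t..<k} \<subseteq> crossing k S t u v"
      using uv pos_free by (auto simp: crossing_def pos_Suc)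
    moreover have "finite (crossing k S t u v)" by (simp add: crossing_def)
    ultimately have "k - c t \<le> card (crossing k S t u v)"
      using card_mono[of "crossing k S t u v" "{c t..<k}"] by simp
    moreover have "we {u, v} + c t \<le> k" using step[of t] \<open>u \<noteq> v\<close> uv by (auto simp: c_def)
    ultimately show "we {u, v} \<le> real (card (crossing k S t u v))" using ck[of t] by linarith
  qed
  have settling: "legal_settling wv k S"
    unfolding legal_settling_def
  proof (intro conjI allI impI)
    fix t show "settle S t \<subseteq> {..<k}" using settle_c[of t] ck[of t] by auto
  next
    fix s t :: nat assume "s \<noteq> t"
    have "settle S s \<inter> settle S t = {}" if "s < t" for s t
      using c_before[OF that] settle_c[of s] by fastforce
    then show "settle S s \<inter> settle S t = {}" using \<open>s \<noteq> t\<close> by (metis inf_commute linorder_neqE_nat)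
  next
    fix t v
    have "{a \<in> settle S t. pos S t a = v} = (if v = f t then settle S t else {})"
      using pos_settle by auto
    then show "card {a \<in> settle S t. pos S t a = v} = (if first_reached k S t v then wv v else 0)"
      using card_settle[of t] by (auto simp: first)
  qed
  have "filled wv k S v" if "v \<in> V" for v
  proof -
    define t where "t = (LEAST t. f t = v)"
    have ft: "f t = v" unfolding t_def using V that by (metis (mono_tags) LeastI imageE)
    have "v \<notin> f ` {..<t}" unfolding t_def using not_less_Least by fastforce
    then have fr: "first_reached k S t v" using ft by (simp add: first)
    \<comment> \<open>An agent settled before \<open>t\<close> has stood still since, so its being
      at \<open>v\<close> would make \<open>v\<close> an earlier vertex of the walk.\<close>
    have "{a \<in> settled S t. pos S t a = v} = {a \<in> settle S t. pos S t a = v}"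
    proof -
      have "a \<in> settle S t" if a: "a \<in> settle S s" "s \<le> t" "pos S t a = v" for a s
      proof (cases "s = t")
        case False
        then obtain t' where t': "t = Suc t'" "s \<le> t'" using a(2) by (cases t) auto
        have "a < c t'" using settle_c[of s] a(1) c_mono[OF t'(2)] by auto
        then have "v = pos S t' a" using a(3) by (simp add: t' pos_Suc)
        then have "v \<in> f ` {..<t}"
          using walk_pos_in_range[of wv f t' a] by (simp add: sel t' lessThan_Suc_atMost)
        then show ?thesis using \<open>v \<notin> f ` {..<t}\<close> by blast
      qed (use a in simp)
      then show ?thesis by (auto simp: settled_def)
    qed
    then have "card {a \<in> settled S t. pos S t a = v} = wv v"
      using settling fr by (simp add: legal_settling_def)
    then show ?thesis using fr by (auto simp: filled_def)
  qed
  then show "valid_strategy V E wv we vs k (walk_strategy wv f)"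
    using moves settling by (simp add: valid_strategy_def S_def)
  have "pos S t a = f t \<and> pos S (Suc t) a = f (Suc t)" if "a \<in> nonsettled k S t" for t a
    using that pos_free[of t a] by (auto simp: nonsettled_def settled pos_Suc)
  then show "single_group k (walk_strategy wv f)"
    by (simp add: single_group_def S_def)
qed

section \<open>Group strategies from arbitrary strategies\<close>

context weighted_tree
begin

lemma single_group_strategy_of_steps:
  assumes steps: "(group_step k)\<^sup>*\<^sup>* ({}, vs) (G, p)" and G: "insert p G = V"
    and k: "1 \<le> k" "sum wv V \<le> k"
    and we: "\<And>e. e \<in> E \<Longrightarrow> we e \<le> real (mw e)"
  shows "\<exists>S. valid_strategy V E wv we vs k S \<and> single_group k S"
proof -
  obtain f n where f: "f 0 = vs" "f n = p" "G = f ` {..<n}"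
    "\<And>i. i < n \<Longrightarrow> f (Suc i) = f i \<or>
       {f i, f (Suc i)} \<in> E \<and> mw {f i, f (Suc i)} + sum wv (f ` {..i}) \<le> k"
    using group_steps_imp_walk[OF steps] by blast
  \<comment> \<open>The finite walk is prolonged by resting at its end.\<close>
  define g where "g i = f (min i n)" for i
  have "range g = f ` {..n}"
  proof
    show "f ` {..n} \<subseteq> range g"
    proof
      fix x assume "x \<in> f ` {..n}"
      then obtain i where "i \<le> n" "x = f i" by blast
      then have "x = g i" by (simp add: g_def)
      then show "x \<in> range g" by blast
    qed
  qed (auto simp: g_def)
  also have "\<dots> = V" using f(2,3) G by (auto simp: lessThan_Suc_atMost[symmetric] lessThan_Suc)
  finally have range: "range g = V" .
  have step: "g (Suc i) = g i \<or> {g i, g (Suc i)} \<in> E \<and>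
      1 + sum wv (g ` {..i}) \<le> k \<and> we {g i, g (Suc i)} + sum wv (g ` {..i}) \<le> k" for i
  proof (cases "i < n")
    case True
    then have "g ` {..i} = f ` {..i}" "g i = f i" "g (Suc i) = f (Suc i)"
      by (auto simp: g_def image_iff)
    moreover have "1 + c \<le> k \<and> we e + c \<le> k" if "e \<in> E" "mw e + c \<le> k" for e c
      using mw_pos[of e] we[OF that(1)] that(2) by linarith
    ultimately show ?thesis using f(4)[OF True] by (auto simp del: of_nat_sum)
  qed (simp add: g_def)
  have "card e = 2" if "e \<in> E" for e
    using tree that by (simp add: is_tree_def simple_graph_def)
  moreover have "g 0 = vs" using f(1) by (simp add: g_def)
  ultimately show ?thesis
    using walk_strategy_valid[of g vs k V wv E we] k finite_V range step by blast
qed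

text \<open>Enough agents to fill all of \<open>V\<close> and still cross any edge can simply tour
  \<open>V\<close>. This makes the minimum in \<open>min_agents\<close> an attained one.\<close>

lemma ex_valid_strategy:
  assumes we: "\<And>e. e \<in> E \<Longrightarrow> we e \<le> real (mw e)"
  shows "\<exists>k S. valid_strategy V E wv we vs k S"
proof -
  have fE: "finite E"
    using finite_V edge_subset by (meson Pow_iff finite_Pow_iff finite_subset subsetI)
  define k where "k = 1 + sum mw E + sum wv V"
  have "mw e + sum wv ({} \<union> V) \<le> k" if "e \<in> E" for e
    using member_le_sum[of e E mw] that fE by (simp add: k_def)
  then have "(group_step k)\<^sup>*\<^sup>* ({}, vs) ({} \<union> V, vs)"
    using connected_V vs finite_V by (intro tour) auto
  then show ?thesis
    using single_group_strategy_of_steps[of k "{} \<union> V" vs we] vs we by (auto simp: k_def)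
qed

end


text \<open>\<open>mw_le\<close> is the minimality of the rounding: a positive number of agents
  sufficient for \<open>we e\<close> is at least \<open>mw e\<close>. The finite horizon
  \<open>T\<close> makes it possible to speak of the last crossing of an edge.\<close>

locale strategy_run = weighted_tree V E wv mw vs
  for V :: "'v set" and E :: "'v set set" and wv :: "'v \<Rightarrow> nat" and mw :: "'v set \<Rightarrow> nat" and vs :: 'v +
  fixes we :: "'v set \<Rightarrow> real" and k :: nat and S :: "'v strategy" and T :: nat
  assumes valid: "valid_strategy V E wv we vs k S"
    and mw_le: "e \<in> E \<Longrightarrow> 1 \<le> n \<Longrightarrow> we e \<le> real n \<Longrightarrow> mw e \<le> n"
    and horizon: "v \<in> V \<Longrightarrow> \<exists>s\<le>T. \<exists>i<k. pos S s i = v"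
begin

text \<open>The inequality is strict: a vertex first reached at time \<open>t\<close> is filled by
  agents still counted in \<open>agents t\<close>, so it belongs to the work ahead.\<close>

definition visited :: "nat \<Rightarrow> 'v set" where
  "visited t = {v. \<exists>s<t. \<exists>i<k. pos S s i = v}"

text \<open>The agents settling at time \<open>t\<close> still count as present at time \<open>t\<close>.\<close>

definition agents :: "nat \<Rightarrow> 'v set \<Rightarrow> nat set" where
  "agents t X = {i. i < k \<and> pos S t i \<in> X \<and> (\<forall>s<t. i \<notin> settle S s)}"

text \<open>The unvisited vertices of such an \<open>X\<close> must be filled by the agents in
  \<open>X\<close> at time \<open>t\<close>, which makes counting local.\<close>

definition isolated :: "'v set \<Rightarrow> nat \<Rightarrow> bool" where
  "isolated X t \<longleftrightarrow> (\<forall>s i. t \<le> s \<longrightarrow> s < T \<longrightarrow> i < k \<longrightarrow> (pos S s i \<in> X \<longleftrightarrow> pos S (Suc s) i \<in> X))"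

section \<open>Visited vertices and crossing agents of the given strategy\<close>

lemma moves: "legal_moves E we vs k S"
  and settling: "legal_settling wv k S"
  using valid by (simp_all add: valid_strategy_def)

lemma pos_0: "i < k \<Longrightarrow> pos S 0 i = vs"
  using moves by (simp add: legal_moves_def)

lemma pos_step: "i < k \<Longrightarrow> pos S (Suc s) i = pos S s i \<or> {pos S s i, pos S (Suc s) i} \<in> E"
  using moves by (simp add: legal_moves_def)

lemma finite_agents: "finite (agents t X)"
  by (simp add: agents_def)

lemma agents_mono: "X \<subseteq> Y \<Longrightarrow> card (agents t X) \<le> card (agents t Y)"
  by (rule card_mono[OF finite_agents]) (auto simp: agents_def)

lemma card_agents_le: "card (agents t X) \<le> k"
proof -
  have "agents t X \<subseteq> {..<k}" by (auto simp: agents_def)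
  then show ?thesis using card_mono[of "{..<k}"] by fastforce
qed

lemma visited_mono: "s \<le> t \<Longrightarrow> visited s \<subseteq> visited t"
  unfolding visited_def using less_le_trans by blast

lemma visitedI: "i < k \<Longrightarrow> s < t \<Longrightarrow> pos S s i \<in> visited t"
  by (auto simp: visited_def)

lemma connected_visited: "connected_in E (visited t)"
proof (rule connected_inI)
  have path: "(vs, pos S s i) \<in> (adj E (visited t))\<^sup>*" if "s < t" "i < k" for s i
    using that(1)
  proof (induction s)
    case 0
    then show ?case using pos_0 that by simp
  next
    case (Suc s)
    have "pos S (Suc s) i = pos S s i \<or> (pos S s i, pos S (Suc s) i) \<in> adj E (visited t)"
      using pos_step[OF that(2), of s] Suc(2) that(2) by (auto simp: adj_def intro: visitedI)
    then show ?case using Suc by (metis Suc_lessD rtrancl.rtrancl_into_rtrancl)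
  qed
  show "(vs, x) \<in> (adj E (visited t))\<^sup>*" if "x \<in> visited t" for x
    using that path by (auto simp: visited_def)
qed

lemma connected_insert_visited:
  assumes y: "y \<in> visited (Suc t)" and ne: "visited t \<noteq> {}"
  shows "connected_in E (insert y (visited t))"
proof (cases "y \<in> visited t")
  case True
  then show ?thesis using connected_visited by (simp add: insert_absorb)
next
  case False
  then obtain i where i: "i < k" "pos S t i = y" using y by (auto simp: visited_def less_Suc_eq)
  obtain t' where t: "t = Suc t'" using ne by (cases t) (auto simp: visited_def)
  have "pos S t' i \<in> visited t" using i t by (auto intro: visitedI)
  moreover from this have "{pos S t' i, y} \<in> E" using pos_step[of i t'] i t False by auto
  ultimately show ?thesis using connected_in_insert connected_visited by metis
qed

lemma pos_in_V: "i < k \<Longrightarrow> pos S s i \<in> V"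
proof (induction s)
  case 0
  then show ?case using pos_0 vs by simp
next
  case (Suc s)
  then show ?case using pos_step[of i s] edge_subset by fastforce
qed

text \<open>Agents that cross together were not settled before, as settled agents never move, and
  they are all at the far end afterwards.\<close>

lemma crossing_agents:
  assumes "{pos S s i, pos S (Suc s) i} \<in> E" "i < k"
  shows "mw {pos S s i, pos S (Suc s) i} \<le> card (agents (Suc s) {pos S (Suc s) i})"
proof -
  define u v where "u = pos S s i" and "v = pos S (Suc s) i"
  have e: "{u, v} \<in> E" using assms by (simp add: u_def v_def)
  have ne: "u \<noteq> v" using tree_edge_neq[OF tree e] .
  have i: "i \<in> crossing k S s u v" using assms by (simp add: crossing_def u_def v_def)
  have sub: "crossing k S s u v \<subseteq> agents (Suc s) {v}"
  proof
    fix j assume "j \<in> crossing k S s u v"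
    then have j: "j < k" "pos S s j = u" "pos S (Suc s) j = v" by (auto simp: crossing_def)
    have "j \<notin> settled S s" using moves j ne by (auto simp: legal_moves_def)
    then show "j \<in> agents (Suc s) {v}" using j by (auto simp: agents_def settled_def)
  qed
  have "we {u, v} \<le> real (card (crossing k S s u v))"
    using moves e i unfolding legal_moves_def by blast
  moreover have "finite (crossing k S s u v)" by (simp add: crossing_def)
  then have "1 \<le> card (crossing k S s u v)" using i by (metis One_nat_def Suc_leI card_gt_0_iff empty_iff)
  ultimately have "mw {u, v} \<le> card (crossing k S s u v)" using mw_le[OF e] by simp
  also have "\<dots> \<le> card (agents (Suc s) {v})" using card_mono[OF finite_agents sub] .
  finally show ?thesis by (simp add: u_def v_def)
qed

section \<open>Regions that exchange no agents\<close>

lemma isolatedD: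
  assumes "isolated X t" "t \<le> s" "s \<le> T" "i < k"
  shows "pos S s i \<in> X \<longleftrightarrow> pos S t i \<in> X"
  using assms(2,3)
proof (induction s rule: dec_induct)
  case (step n)
  then show ?case using assms(1,4) by (auto simp: isolated_def)
qed simp

text \<open>The edge \<open>{a, b}\<close> is the only link between the two branches, and nobody
  enters or leaves \<open>B\<close>.\<close>

lemma isolated_branch:
  assumes e: "{a, b} \<in> E" and B: "connected_in E B" "a \<in> B" "b \<in> B" "isolated B t"
    and uncrossed: "\<And>s i. t \<le> s \<Longrightarrow> s < T \<Longrightarrow> i < k \<Longrightarrow> {pos S s i, pos S (Suc s) i} \<noteq> {a, b}"
  shows "isolated (branch E B a b) t"
  unfolding isolated_def
proof (intro allI impI)
  fix s i assume s: "t \<le> s" "s < T" "i < k"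
  define u v where "u = pos S s i" and "v = pos S (Suc s) i"
  have uvB: "u \<in> B \<longleftrightarrow> v \<in> B" using B(4) s by (auto simp: isolated_def u_def v_def)
  have uv: "u = v \<or> {u, v} \<in> E" using pos_step[OF s(3), of s] by (auto simp: u_def v_def)
  have ne: "{u, v} \<noteq> {a, b}" using uncrossed[OF s] by (simp add: u_def v_def)
  note cover = branch_cover[OF B(1-3)]
  note disj = branch_disjoint[OF tree e, of B]
  have "y \<in> branch E B a b"
    if x: "x \<in> branch E B a b" and y: "y \<in> B" and xy: "x = y \<or> {x, y} \<in> E" "{x, y} \<noteq> {a, b}" for x y
  proof (rule ccontr)
    assume "y \<notin> branch E B a b"
    then have "y \<in> branch E B b a" "x \<noteq> y" using cover x y by auto
    then show False using branch_edge[OF tree e x, of y] xy by auto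
  qed
  from this[of u v] this[of v u] have "u \<in> branch E B a b \<longleftrightarrow> v \<in> branch E B a b"
    using uv ne uvB branch_subset[of E B a b] by (auto simp: insert_commute)
  then show "pos S s i \<in> branch E B a b \<longleftrightarrow> pos S (Suc s) i \<in> branch E B a b"
    by (simp add: u_def v_def)
qed

text \<open>Agents settling on vertices of \<open>D\<close> new since \<open>t\<close> are in
  \<open>B\<close> at time \<open>t\<close>. They differ from the agents in \<open>A\<close> at time
  \<open>t'\<close>: those remain in \<open>A\<close>, whose part of \<open>D\<close> was reached
  before \<open>t'\<close>, so they no longer settle in \<open>D\<close>. Both sets thus fit
  disjointly into \<open>agents t B\<close>.\<close>

lemma settling_count:
  assumes B: "isolated B t" and A: "isolated A t'" and t: "t \<le> t'" "t' \<le> T"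
    and sub: "A \<subseteq> B" "D \<subseteq> B" "D \<subseteq> V" and DA: "D \<inter> A \<subseteq> visited t'"
  shows "sum wv (D - visited t) + card (agents t' A) \<le> card (agents t B)"
proof -
  define Q where "Q s v = {i \<in> settle S s. pos S s i = v}" for s v
  have cardQ: "card (Q s v) = (if first_reached k S s v then wv v else 0)" for s v
    using settling by (simp add: legal_settling_def Q_def)
  have Qk: "Q s v \<subseteq> {..<k}" for s v
    using settling by (auto simp: legal_settling_def Q_def)
  have once: "s = s'" if "i \<in> settle S s" "i \<in> settle S s'" for i s s'
    using settling that unfolding legal_settling_def by blast
  have "\<exists>s\<le>T. first_reached k S s v" if v: "v \<in> V" for v
  proof -
    obtain s0 where s0: "s0 \<le> T" "\<exists>i<k. pos S s0 i = v" using horizon[OF v] by blast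
    then obtain s where s: "\<exists>i<k. pos S s i = v" "\<forall>r<s. \<not> (\<exists>i<k. pos S r i = v)"
      using exists_least_iff[of "\<lambda>s. \<exists>i<k. pos S s i = v"] by blast
    then have "s \<le> s0" using s0(2) by (meson not_less)
    then have "s \<le> T" using s0(1) by simp
    moreover have "first_reached k S s v" using s by (auto simp: first_reached_def)
    ultimately show ?thesis by blast
  qed
  \<comment> \<open>\<open>\<tau> v\<close> is the time of the first arrival at \<open>v\<close>,
    the only time at which agents settle there.\<close>
  then obtain \<tau> where \<tau>: "\<And>v. v \<in> V \<Longrightarrow> \<tau> v \<le> T \<and> first_reached k S (\<tau> v) v" by metis
  define Z where "Z = (\<Union>v\<in>D - visited t. Q (\<tau> v) v)"
  have finD: "finite D" using sub(3) finite_V finite_subset by blast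
  have finQ: "finite (Q s v)" for s v using Qk finite_subset by blast
  have late: "t \<le> \<tau> v" if "v \<in> D - visited t" for v
  proof (rule ccontr)
    assume "\<not> t \<le> \<tau> v"
    moreover have "first_reached k S (\<tau> v) v" using \<tau>[of v] that sub(3) by blast
    ultimately have "v \<in> visited t" unfolding first_reached_def visited_def not_le by blast
    then show False using that by blast
  qed
  have "card Z = (\<Sum>v\<in>D - visited t. card (Q (\<tau> v) v))"
    unfolding Z_def
  proof (rule card_UN_disjoint)
    show "\<forall>u\<in>D - visited t. \<forall>v\<in>D - visited t. u \<noteq> v \<longrightarrow> Q (\<tau> u) u \<inter> Q (\<tau> v) v = {}"
      using once by (fastforce simp: Q_def)
  qed (use finD finQ in auto)
  also have "\<dots> = sum wv (D - visited t)"
    using \<tau> sub(3) by (intro sum.cong) (auto simp: cardQ)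
  finally have cardZ: "card Z = sum wv (D - visited t)" .
  have "Z \<inter> agents t' A = {}"
  proof (rule ccontr)
    assume "Z \<inter> agents t' A \<noteq> {}"
    then obtain i v where v: "v \<in> D" "v \<notin> visited t" "i \<in> settle S (\<tau> v)" "pos S (\<tau> v) i = v"
      and i: "i < k" "pos S t' i \<in> A" "\<And>s. s < t' \<Longrightarrow> i \<notin> settle S s"
      by (auto simp: Z_def Q_def agents_def)
    have \<tau>v: "\<tau> v \<le> T" "first_reached k S (\<tau> v) v" using \<tau>[of v] v sub(3) by auto
    have "t' \<le> \<tau> v" using i(3) v(3) by (meson not_less)
    then have "v \<in> A" using isolatedD[OF A _ \<tau>v(1) i(1)] i(2) v(4) by auto
    then have "v \<in> visited t'" using DA v(1) by blast
    then obtain s where "s < t'" "\<exists>i<k. pos S s i = v" by (auto simp: visited_def)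
    moreover from this have "s < \<tau> v" using \<open>t' \<le> \<tau> v\<close> by simp
    ultimately show False using \<tau>v(2) unfolding first_reached_def by blast
  qed
  moreover have "Z \<subseteq> agents t B"
  proof
    fix i assume "i \<in> Z"
    then obtain v where v: "v \<in> D - visited t" "i \<in> settle S (\<tau> v)" "pos S (\<tau> v) i = v" "i < k"
      using Qk by (fastforce simp: Z_def Q_def)
    then have "v \<in> B" "\<tau> v \<le> T" using \<tau>[of v] sub by auto
    then have "pos S t i \<in> B"
      using isolatedD[OF B late[OF v(1)], of i] v(3,4) by simp
    moreover have "i \<notin> settle S s" if "s < t" for s
      using once[of i s "\<tau> v"] late[OF v(1)] v(2) that by auto
    ultimately show "i \<in> agents t B" using v(4) by (auto simp: agents_def)
  qed
  moreover have "agents t' A \<subseteq> agents t B"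
    using isolatedD[OF B t] t(1) sub(1) by (auto simp: agents_def)
  moreover have "finite Z" using finD finQ by (simp add: Z_def)
  ultimately have "card Z + card (agents t' A) \<le> card (agents t B)"
    using card_Un_disjoint[OF \<open>finite Z\<close> finite_agents[of t' A]]
      card_mono[OF finite_agents[of t B], of "Z \<union> agents t' A"] by simp
  then show ?thesis by (simp add: cardZ)
qed

text \<open>The side of \<open>b\<close> is the one entered last. If \<open>e\<close> is not crossed
  any more, it is the side containing \<open>q\<close>, and time and place are kept.\<close>

lemma last_crossing:
  assumes B: "connected_in E B" "q \<in> B" "t \<le> T" and e: "e \<in> E" "e \<subseteq> B"
    and group: "mw e \<le> card (agents t {q})"
  obtains a b t' q' where "e = {a, b}" "t \<le> t'" "t' \<le> T" "q' \<in> branch E B b a"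
    "\<And>s i. t' \<le> s \<Longrightarrow> s < T \<Longrightarrow> i < k \<Longrightarrow> {pos S s i, pos S (Suc s) i} \<noteq> e"
    "mw e \<le> card (agents t' {q'})"
    "t' = t \<and> q' = q \<or> t < t' \<and> q' = b \<and> a \<in> visited t'"
proof -
  define R where "R = {s. t \<le> s \<and> s < T \<and> (\<exists>i<k. {pos S s i, pos S (Suc s) i} = e)}"
  have finR: "finite R" by (simp add: R_def)
  show ?thesis
  proof (cases "R = {}")
    case True
    have "card e = 2" using tree e by (simp add: is_tree_def simple_graph_def)
    then obtain x y where xy: "e = {x, y}" by (meson card_2_iff)
    have "q \<in> branch E B x y \<union> branch E B y x" using branch_cover[OF B(1), of x y] B(2) e xy by auto
    then obtain a b where "e = {a, b}" "q \<in> branch E B b a" using xy by blast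
    then show ?thesis using that[of a b t q] True B(3) group by (auto simp: R_def)
  next
    case False
    define s where "s = Max R"
    have "s \<in> R" using Max_in[OF finR False] by (simp add: s_def)
    \<comment> \<open>Any agent crossing in this last step may fix the direction, even if others
      cross the opposite way in the same step.\<close>
    then obtain i where s: "t \<le> s" "s < T" "i < k" "{pos S s i, pos S (Suc s) i} = e"
      by (auto simp: R_def)
    have after: "{pos S r j, pos S (Suc r) j} \<noteq> e" if "Suc s \<le> r" "r < T" "j < k" for r j
    proof
      assume "{pos S r j, pos S (Suc r) j} = e"
      then have "r \<in> R" using that s(1) by (auto simp: R_def)
      then show False using Max_ge[OF finR, of r] that(1) by (simp add: s_def)
    qed
    have "mw e \<le> card (agents (Suc s) {pos S (Suc s) i})"
      using crossing_agents[of s i] s e by simp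
    moreover have "pos S (Suc s) i \<in> branch E B (pos S (Suc s) i) (pos S s i)"
      using e s(4) by (intro branch_self) auto
    moreover have "pos S s i \<in> visited (Suc s)" using s(3) by (simp add: visitedI)
    ultimately show ?thesis
      using that[of "pos S s i" "pos S (Suc s) i" "Suc s" "pos S (Suc s) i"] s after by auto
  qed
qed

text \<open>
  The other agents present in \<open>B\<close> may be scattered. We cut \<open>B\<close> at a heaviest edge \<open>e\<close> and look
  at the last time \<open>t'\<close> at which \<open>e\<close> is crossed, say into the part \<open>A2\<close>. The agents in \<open>A2\<close> at that time
  number at least \<open>mw e\<close> and are not needed for the vertices in \<open>D\<close>, which are all other vertices
  apart from those of \<open>A2\<close> reached later. So the single group can roam in \<open>D\<close> without
  restriction until \<open>D\<close> is filled, and then enter \<open>A2\<close> for good. The disjunctive assumption on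
  \<open>q\<close> guarantees that it need not settle agents at \<open>q\<close> before \<open>D\<close> is filled unless \<open>q \<in> D\<close>.
\<close>

lemma group_fills_isolated:
  assumes "connected_in E B" "B \<subseteq> V" "q \<in> B" "t \<le> T" "isolated B t"
    and "\<And>e. e \<in> E \<Longrightarrow> e \<subseteq> B \<Longrightarrow> mw e \<le> card (agents t {q})"
    and "q \<in> visited t \<or> visited (Suc t) \<inter> B \<subseteq> {q}"
    and "finite G" "G \<inter> B = visited t \<inter> B" "sum wv G + card (agents t B) \<le> k"
  shows "\<exists>G' p. (group_step k)\<^sup>*\<^sup>* (G, q) (G', p) \<and> insert p G' = G \<union> B"
  using assms
proof (induction "card B" arbitrary: B q t G rule: less_induct)
  case less
  note B = less.prems(1-5) and group = less.prems(6) and q = less.prems(7) and G = less.prems(8-10)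
  have finB: "finite B" using B(2) finite_V finite_subset by blast
  show ?case
  proof (cases "B = {q}")
    case True
    then have "(group_step k)\<^sup>*\<^sup>* (G, q) (G, q) \<and> insert q G = G \<union> B" by simp
    then show ?thesis by blast
  next
    case False
    define EB where "EB = {e \<in> E. e \<subseteq> B}"
    have "EB \<subseteq> Pow B" by (auto simp: EB_def)
    then have finEB: "finite EB" using finB finite_subset by blast
    obtain x where "x \<in> B" "x \<noteq> q" using False B(3) by blast
    then have "(q, x) \<in> (adj E B)\<^sup>*" "q \<noteq> x" using connected_inD[OF B(1,3)] by auto
    then obtain z where "(q, z) \<in> adj E B" by (meson converse_rtranclE)
    then have "{q, z} \<in> EB" by (auto simp: EB_def adj_def)
    then have neEB: "EB \<noteq> {}" by blast
    have "Max (mw ` EB) \<in> mw ` EB" using finEB neEB by simp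
    then obtain e where e: "e \<in> E" "e \<subseteq> B" and "mw e = Max (mw ` EB)" by (auto simp: EB_def)
    then have heaviest: "mw e' \<le> mw e" if "e' \<in> E" "e' \<subseteq> B" for e'
      using that finEB by (auto simp: EB_def)
    obtain a b t' q' where ab: "e = {a, b}" and t': "t \<le> t'" "t' \<le> T"
      and q'A2: "q' \<in> branch E B b a"
      and uncrossed: "\<And>s i. t' \<le> s \<Longrightarrow> s < T \<Longrightarrow> i < k \<Longrightarrow> {pos S s i, pos S (Suc s) i} \<noteq> e"
      and group': "mw e \<le> card (agents t' {q'})"
      and last: "t' = t \<and> q' = q \<or> t < t' \<and> q' = b \<and> a \<in> visited t'"
      using last_crossing[OF B(1,3,4) e group[OF e]] by metis
    have abB: "a \<in> B" "b \<in> B" and abE: "{a, b} \<in> E" and baE: "{b, a} \<in> E"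
      using e ab by (auto simp: insert_commute)
    define A1 where "A1 = branch E B a b"
    define A2 where "A2 = branch E B b a"
    define D where "D = A1 \<union> (visited t' \<inter> A2)"
    have A: "A1 \<union> A2 = B" "A1 \<inter> A2 = {}" "a \<in> A1" "b \<in> A2" "connected_in E A1" "connected_in E A2"
      using branch_cover[OF B(1) abB] branch_disjoint[OF tree abE] abB
      by (auto simp: A1_def A2_def branch_self connected_in_branch)
    have q': "q' \<in> A2" using q'A2 by (simp add: A2_def)
    have isoB: "isolated B t'" using B(5) t'(1) by (auto simp: isolated_def)
    have iso: "isolated A1 t'" "isolated A2 t'"
      unfolding A1_def A2_def
      using isolated_branch[OF abE B(1) abB isoB] isolated_branch[OF baE B(1) abB(2,1) isoB]
        uncrossed ab by (auto simp: insert_commute)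
    have cut: "b \<in> X" if "connected_in E X" "x \<in> X \<inter> A1" "y \<in> X \<inter> A2" for X x y
      using connected_set_contains_cut_vertex[OF tree abE, of x B y X] that by (auto simp: A1_def A2_def)
    have "1 \<le> mw e" by (rule mw_pos)
    then have "agents t {q} \<noteq> {}" using group[OF e] by fastforce
    then obtain i0 where i0: "i0 < k" "pos S t i0 = q" by (auto simp: agents_def)
    \<comment> \<open>If \<open>a\<close> is not reached before \<open>t'\<close>, the agent that
      reaches it by time \<open>T\<close> is in \<open>A1\<close> at time \<open>t'\<close> already,
      because \<open>A1\<close> is isolated.\<close>
    obtain y where y: "y \<in> visited (Suc t')" "y \<in> A1"
    proof -
      obtain r i where r: "r \<le> T" "i < k" "pos S r i = a" using horizon[of a] abB B(2) by blast
      show ?thesis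
      proof (cases "r < t'")
        case True
        then show ?thesis using that[of a] r A(3) visitedI[of i r "Suc t'"] by auto
      next
        case False
        then show ?thesis using that[of "pos S t' i"] r A(3) isolatedD[OF iso(1) _ r(1,2)]
          by (auto intro: visitedI)
      qed
    qed
    \<comment> \<open>This is the disjunctive assumption for the recursive call. After a crossing
      \<open>a\<close> is visited, and visited sets are connected, so \<open>A2\<close> can be
      entered only through \<open>b\<close>.\<close>
    have q'_new: "q' \<in> visited t' \<or> visited (Suc t') \<inter> A2 \<subseteq> {q'}"
    proof (cases "t' = t \<and> q' = q")
      case True
      then show ?thesis using q A(1) by blast
    next
      case False
      then have crossed: "q' = b" "a \<in> visited t'" using last by auto
      have "x = b" if "b \<notin> visited t'" "x \<in> visited (Suc t')" "x \<in> A2" for x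
      proof -
        have "connected_in E (insert x (visited t'))"
          using connected_insert_visited that(2) crossed by blast
        then show ?thesis using cut[of "insert x (visited t')" a x] crossed A(3) that by blast
      qed
      then show ?thesis using crossed by blast
    qed
    have q'_old: "q' \<in> visited t'" if "visited t' \<inter> A2 \<noteq> {}"
      using q'_new that visited_mono[of t' "Suc t'"] by auto
    \<comment> \<open>Otherwise \<open>q\<close> is an unvisited vertex of \<open>A2\<close> and
      \<open>t' = t\<close>; then \<open>visited (Suc t)\<close> meets \<open>B\<close> at most in
      \<open>q\<close>, contradicting \<open>y\<close>.\<close>
    have qD: "q \<in> D"
    proof (cases "q \<in> A1")
      case False
      have "q \<in> visited t'"
      proof (cases "t' = t")
        case True
        show ?thesis
        proof (rule ccontr)
          assume "q \<notin> visited t'"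
          then have "visited (Suc t) \<inter> B \<subseteq> {q}" using q True by blast
          then have "y = q" using y A(1) True by blast
          then show False using y False by blast
        qed
      next
        case False
        then show ?thesis using visitedI[OF i0(1), of t t'] i0(2) t'(1) by simp
      qed
      then show ?thesis using False B(3) A(1) by (auto simp: D_def)
    qed (simp add: D_def)
    have DB: "D \<subseteq> B" using A(1) by (auto simp: D_def)
    have finD: "finite D" using DB finB finite_subset by blast
    have A2B: "A2 \<subseteq> B" using A(1) by blast
    \<comment> \<open>The agents in \<open>A2\<close> at time \<open>t'\<close> never settle on the
      unfilled vertices of \<open>D\<close>, so their number is left over after
      \<open>G \<union> D\<close> is paid for.\<close>
    have "D \<inter> A2 \<subseteq> visited t'" using A(2) by (auto simp: D_def)
    then have "sum wv (D - visited t) + card (agents t' A2) \<le> card (agents t B)"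
      using settling_count[OF B(5) iso(2) t' A2B DB] DB B(2) by blast
    moreover have "sum wv (G \<union> D) = sum wv G + sum wv (D - visited t)"
    proof -
      have "D - visited t = D - G" using DB G(2) by blast
      then show ?thesis
        using sum.union_disjoint[of G "D - G" wv] G(1) finD by simp
    qed
    ultimately have budget: "sum wv (G \<union> D) + card (agents t' A2) \<le> k" using G(3) by linarith
    have "card (agents t' {q'}) \<le> card (agents t' A2)" using q' by (intro agents_mono) auto
    then have "mw e + sum wv (G \<union> D) \<le> k" using group' budget by linarith
    then have allowed: "mw e' + sum wv (G \<union> D) \<le> k" if "e' \<in> E" "e' \<subseteq> B" for e'
      using heaviest[OF that] by linarith
    have steps: "(group_step k)\<^sup>*\<^sup>* (G, q) (G \<union> D, q')"
    proof (cases "visited t' \<inter> A2 = {}")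
      case True
      \<comment> \<open>\<open>A2\<close> is untouched: the group tours \<open>A1\<close>, ends at
        \<open>a\<close> and finally crosses to \<open>b\<close> without settling there yet.\<close>
      then have D: "D = A1" by (simp add: D_def)
      then have b: "q' = b" using last qD q' A(2) by blast
      have "(group_step k)\<^sup>*\<^sup>* (G, q) (G \<union> D, a)"
        using D A(3,5) qD G(1) finD allowed DB by (intro tour) auto
      moreover have "insert a (G \<union> D) = G \<union> D" using D A(3) by blast
      then have "group_step k (G \<union> D, a) (G \<union> D, b)"
        using move[OF abE, of "G \<union> D" k] allowed[OF e] ab by simp
      ultimately show ?thesis using b by auto
    next
      case False
      then have q'F: "q' \<in> visited t'" by (rule q'_old)
      \<comment> \<open>The visited part of \<open>A2\<close> must contain \<open>b\<close>, so that
        the edge \<open>{a, b}\<close> joins it to \<open>A1\<close> and \<open>D\<close> is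
        connected.\<close>
      have "b \<in> visited t'"
      proof (cases "q' = b")
        case False
        have "connected_in E (insert y (visited t'))"
          using connected_insert_visited y q'F by blast
        then have "b \<in> insert y (visited t')" using cut[of _ y q'] y q' q'F by blast
        then show ?thesis using A(2,4) y by blast
      qed (use q'F in simp)
      then have "connected_in E D"
        unfolding D_def using A(3-6) connected_in_Int[OF tree connected_visited A(6)] abE
        by (intro connected_in_Un_edge[of E A1 "visited t' \<inter> A2" a b]) auto
      moreover have "q' \<in> D" using q' q'F by (simp add: D_def)
      ultimately show ?thesis using qD G(1) finD allowed DB by (intro tour) auto
    qed
    have "A2 \<subset> B" using A(1-3) by blast
    then have "card A2 < card B" using finB psubset_card_mono by blast
    moreover have "(G \<union> D) \<inter> A2 = visited t' \<inter> A2"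
      using G(2) A(1,2) visited_mono[OF t'(1)] by (auto simp: D_def)
    moreover have "A2 \<subseteq> V" "finite (G \<union> D)" using A2B B(2) G(1) finD by auto
    moreover have "mw e' \<le> card (agents t' {q'})" if "e' \<in> E" "e' \<subseteq> A2" for e'
      using heaviest[of e'] that A2B group' by fastforce
    ultimately obtain G' p where
      "(group_step k)\<^sup>*\<^sup>* (G \<union> D, q') (G', p)" "insert p G' = (G \<union> D) \<union> A2"
      using less.hyps[of A2 q' t' "G \<union> D"] A(6) q' t'(2) iso(2) q'_new budget by blast
    moreover have "(G \<union> D) \<union> A2 = G \<union> B" using A(1) DB by (auto simp: D_def)
    ultimately show ?thesis using steps by (metis rtranclp_trans)
  qed
qed

section \<open>Application to the whole tree\<close>

lemma isolated_V: "isolated V t"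
  using pos_in_V by (simp add: isolated_def)

text \<open>An edge never crossed would leave the side away from \<open>vs\<close> unreached. The
  bound lets all \<open>k\<close> agents at \<open>vs\<close> meet the group assumption of the
  induction at time 0.\<close>

lemma edge_weight_le:
  assumes "e \<in> E" shows "mw e \<le> k"
proof -
  have "\<exists>s i. i < k \<and> {pos S s i, pos S (Suc s) i} = e"
  proof (rule ccontr)
    assume uncrossed: "\<nexists>s i. i < k \<and> {pos S s i, pos S (Suc s) i} = e"
    have "card e = 2" using tree assms by (simp add: is_tree_def simple_graph_def)
    then obtain x y where "e = {x, y}" by (meson card_2_iff)
    moreover from this have "vs \<in> branch E V x y \<union> branch E V y x"
      using branch_cover[OF connected_V, of x y] vs edge_subset[OF assms] by auto
    ultimately obtain a b where ab: "e = {a, b}" "vs \<in> branch E V a b" by blast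
    have abE: "{a, b} \<in> E" and abV: "a \<in> V" "b \<in> V" using ab assms edge_subset by auto
    obtain s i where s: "s \<le> T" "i < k" "pos S s i = b" using horizon[OF abV(2)] by blast
    have "isolated (branch E V a b) 0"
      using isolated_branch[OF abE connected_V abV isolated_V] uncrossed ab(1) by blast
    then have "b \<in> branch E V a b" using isolatedD[of _ 0 s i] s pos_0[of i] ab(2) by auto
    moreover have "b \<in> branch E V b a" using abV by (simp add: branch_self)
    ultimately show False using branch_disjoint[OF tree abE] by blast
  qed
  then obtain s i where "i < k" "{pos S s i, pos S (Suc s) i} = e" by blast
  then show ?thesis using crossing_agents[of s i] card_agents_le le_trans assms by metis
qed

lemma single_group_strategy:
  assumes we: "\<And>e. e \<in> E \<Longrightarrow> we e \<le> real (mw e)"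
  shows "\<exists>S. valid_strategy V E wv we vs k S \<and> single_group k S"
proof -
  have start: "agents 0 {vs} = {..<k}" "agents 0 V = {..<k}" "visited 0 = {}"
    "visited (Suc 0) \<inter> V \<subseteq> {vs}"
    using pos_0 vs by (auto simp: agents_def visited_def)
  have "\<exists>G p. (group_step k)\<^sup>*\<^sup>* ({}, vs) (G, p) \<and> insert p G = {} \<union> V"
    using start edge_weight_le connected_V vs isolated_V
    by (intro group_fills_isolated[where t = 0]) auto
  then obtain G p where "(group_step k)\<^sup>*\<^sup>* ({}, vs) (G, p)" "insert p G = V" by auto
  \<comment> \<open>With \<open>A\<close> empty the counting lemma bounds the total weight.\<close>
  moreover have "isolated {} 0" by (simp add: isolated_def)
  then have "sum wv V \<le> k"
    using settling_count[OF isolated_V[of 0], of "{}" 0 V] start by auto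
  moreover have "1 \<le> k" using horizon[OF vs] by auto
  ultimately show ?thesis using single_group_strategy_of_steps we by blast
qed

end

theorem theorem3:
  fixes V :: "'v set" and E :: "'v set set"
    and wv :: "'v \<Rightarrow> nat" and we :: "'v set \<Rightarrow> real" and vs :: 'v
  assumes "is_tree V E"
    and "\<forall>e\<in>E. 0 \<le> we e"
    and "vs \<in> V"
  shows "\<exists>S. valid_strategy V E wv we vs (min_agents V E wv we vs) S \<and>
             single_group (min_agents V E wv we vs) S"
proof -
  \<comment> \<open>At least one agent is needed to cross an edge, even if its weight is 0.\<close>
  define mw where "mw e = max 1 (nat \<lceil>we e\<rceil>)" for e
  interpret weighted_tree V E wv mw vs
    using assms by unfold_locales (auto simp: mw_def)
  have we: "we e \<le> real (mw e)" for e
    unfolding mw_def by linarith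
  define k where "k = min_agents V E wv we vs"
  obtain S where S: "valid_strategy V E wv we vs k S"
    using ex_valid_strategy[of we] we LeastI_ex[of "\<lambda>k. \<exists>S. valid_strategy V E wv we vs k S"]
    by (auto simp: k_def min_agents_def)
  have "\<exists>s. \<exists>i<k. pos S s i = v" if "v \<in> V" for v
    using S that unfolding valid_strategy_def filled_def first_reached_def by blast
  then obtain \<tau> where \<tau>: "\<And>v. v \<in> V \<Longrightarrow> \<exists>i<k. pos S (\<tau> v) i = v" by metis
  interpret strategy_run V E wv mw vs we k S "Max (\<tau> ` V)"
  proof unfold_locales
    show "mw e \<le> n" if "1 \<le> n" "we e \<le> real n" for e n
      using that unfolding mw_def by (simp add: ceiling_le_iff nat_le_iff)
    show "\<exists>s\<le>Max (\<tau> ` V). \<exists>i<k. pos S s i = v" if "v \<in> V" for v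
      using \<tau>[OF that] that finite_V by (meson Max_ge finite_imageI imageI)
  qed (rule S)
  show ?thesis using single_group_strategy we by (simp add: k_def)
qed

end
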